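(* Let $\mathscr{A}=(\mathscr{A},f,g)$ be a commutative Krasner $(m,n)$-hyperring with scalar identity $1_{\mathscr{A}}$, let $S$ be an $n$-ary multiplicative subset of $\mathscr{A}$ and let $P$ be an $n$-ary $S$-hyperideal of $\mathscr{A}$. Then: (1) $P\cap S=\varnothing$. (2) ${\bf r}(P)$ is an $n$-ary $S$-hyperideal of $\mathscr{A}$. (3) For every non-empty subset $Q\subseteq \mathscr{A}\setminus P$, the set $P_Q=\{a\in\mathscr{A} \mid g(a,Q,1_{\mathscr{A}}^{(n-2)})\subseteq P\}$ is an $n$-ary $S$-hyperideal of $\mathscr{A}$.
   Context: Let $m,n\ge 2$. Notation: $p_i^j$ denotes the sequence $p_i,\dots,p_j$ (empty if $j<i$); $p^{(k)}$ denotes $p$ repeated $k$ times; for non-empty subsets, $f(P_1^m)=\bigcup\{f(p_1^m)\mid p_i\in P_i\}$ and similarly for $g$; singletons are identified with elements. A canonical $m$-ary hypergroup $(\mathscr{A},f)$ is a set with $f:\mathscr{A}^m\to\{\text{non-empty subsets of }\mathscr{A}\}$ such that: $f$ is associative ($f(p_1^{i-1},f(p_i^{m+i-1}),p_{m+i}^{2m-1})$ is independent of $i$) and invariant under permutations of its arguments; there is a unique $0$ with $f(p,0^{(m-1)})=\{p\}$ for all $p$; each $p$ has a unique $-p$ with $0\in f(p,-p,0^{(m-2)})$; and $p\in f(p_1^m)$ implies $p_i\in f(p,-p_1,\dots,-p_{i-1},-p_{i+1},\dots,-p_m)$ for each $i$. A commutative Krasner $(m,n)$-hyperring with scalar identity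 $1_{\mathscr{A}}$ is $(\mathscr{A},f,g)$ with $(\mathscr{A},f)$ a canonical $m$-ary hypergroup, $g:\mathscr{A}^n\to\mathscr{A}$ an associative operation invariant under permutations of its arguments, $g$ distributive over $f$ in each argument ($g(p_1^{i-1},f(q_1^m),p_{i+1}^n)=f(g(p_1^{i-1},q_1,p_{i+1}^n),\dots,g(p_1^{i-1},q_m,p_{i+1}^n))$), $g(0,p_2^n)=0$, and $g(p,1_{\mathscr{A}}^{(n-1)})=p$ for all $p$. A hyperideal is a non-empty $P\subseteq\mathscr{A}$ with $f(p_1^m)\subseteq P$ and $-p\in P$ for all $p,p_1,\dots,p_m\in P$, and $g(p_1^{i-1},P,p_{i+1}^n)\subseteq P$ for all $p_j\in\mathscr{A}$ and all $i$; it is proper if $P\ne\mathscr{A}$. A proper hyperideal $P$ is $n$-ary prime if $g(p_1^n)\in P$ implies $p_i\in P$ for some $i$. The radical ${\bf r}(P)$ is the intersection of all $n$-ary prime hyperideals containing $P$ (and ${\bf r}(P)=\mathscr{A}$ if there are none). An $n$-ary multiplicative subset is a non-empty $S\subseteq\mathscr{A}$ with $g(s_1^n)\in S$ for all $s_1,\dots,s_n\in S$. Given such $S$, an $n$-ary $S$-hyperideal is a proper hyperideal $P$ such that whenever $g(p_1^n)\in P$ with $p_1,\dots,p_n\in\mathscr{A}$ and $p_i\in S$ for some $i$, then $g(p_1^{i-1},1_{\mathscr{A}},p_{i+1}^n)\in P$. *)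

theory Defs
  imports "HOL-Combinatorics.Permutations"
begin

text \<open>
  Operations of arity \<open>k\<close> on a carrier \<open>A\<close> act on lists and are constrained only on
  \<open>tuples k A\<close>. Positions are counted from \<open>0\<close>.
\<close>

definition tuples :: "nat \<Rightarrow> 'a set \<Rightarrow> 'a list set" where
  "tuples k A = {xs. length xs = k \<and> set xs \<subseteq> A}"

abbreviation singles :: "'a list \<Rightarrow> 'a set list" where
  "singles xs \<equiv> map (\<lambda>x. {x}) xs"

text \<open>Extensions of a hyperoperation and of an operation to lists of subsets.\<close>

definition hlift :: "('a list \<Rightarrow> 'a set) \<Rightarrow> 'a set list \<Rightarrow> 'a set" where
  "hlift f Ps = (\<Union>ps\<in>listset Ps. f ps)"

definition lift :: "('a list \<Rightarrow> 'a) \<Rightarrow> 'a set list \<Rightarrow> 'a set" where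
  "lift g Ps = g ` listset Ps"

definition is_zero :: "nat \<Rightarrow> 'a set \<Rightarrow> ('a list \<Rightarrow> 'a set) \<Rightarrow> 'a \<Rightarrow> bool" where
  "is_zero m A f z \<longleftrightarrow> z \<in> A \<and> (\<forall>p\<in>A. f (p # replicate (m - 1) z) = {p})"

definition hzero :: "nat \<Rightarrow> 'a set \<Rightarrow> ('a list \<Rightarrow> 'a set) \<Rightarrow> 'a" where
  "hzero m A f = (THE z. is_zero m A f z)"

definition is_neg :: "nat \<Rightarrow> 'a set \<Rightarrow> ('a list \<Rightarrow> 'a set) \<Rightarrow> 'a \<Rightarrow> 'a \<Rightarrow> bool" where
  "is_neg m A f p q \<longleftrightarrow>
     q \<in> A \<and> hzero m A f \<in> f (p # q # replicate (m - 2) (hzero m A f))"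

definition hneg :: "nat \<Rightarrow> 'a set \<Rightarrow> ('a list \<Rightarrow> 'a set) \<Rightarrow> 'a \<Rightarrow> 'a" where
  "hneg m A f p = (THE q. is_neg m A f p q)"

locale canonical_hypergroup =
  fixes m :: nat and A :: "'a set" and f :: "'a list \<Rightarrow> 'a set"
  assumes arity_f: "2 \<le> m"
    and f_closed: "xs \<in> tuples m A \<Longrightarrow> f xs \<noteq> {} \<and> f xs \<subseteq> A"
    and f_assoc: "\<lbrakk>xs \<in> tuples (2 * m - 1) A; i < m; j < m\<rbrakk> \<Longrightarrow>
      hlift f (singles (take i xs) @ [f (take m (drop i xs))] @ singles (drop (i + m) xs)) =
      hlift f (singles (take j xs) @ [f (take m (drop j xs))] @ singles (drop (j + m) xs))"
    and f_sym: "\<lbrakk>xs \<in> tuples m A; \<sigma> permutes {..<m}\<rbrakk> \<Longrightarrow> f (permute_list \<sigma> xs) = f xs"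
    and ex1_zero: "\<exists>!z. is_zero m A f z"
    and ex1_neg: "p \<in> A \<Longrightarrow> \<exists>!q. is_neg m A f p q"
    and reversible: "\<lbrakk>ps \<in> tuples m A; p \<in> f ps; i < m\<rbrakk> \<Longrightarrow>
      ps ! i \<in> f (p # map (hneg m A f) (take i ps @ drop (Suc i) ps))"

locale comm_krasner_hyperring =
  canonical_hypergroup m A f
  for m n :: nat and A :: "'a set" and f :: "'a list \<Rightarrow> 'a set"
    and g :: "'a list \<Rightarrow> 'a" and one :: 'a +
  assumes arity_g: "2 \<le> n"
    and g_closed: "xs \<in> tuples n A \<Longrightarrow> g xs \<in> A"
    and g_assoc: "\<lbrakk>xs \<in> tuples (2 * n - 1) A; i < n; j < n\<rbrakk> \<Longrightarrow>
      g (take i xs @ [g (take n (drop i xs))] @ drop (i + n) xs) =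
      g (take j xs @ [g (take n (drop j xs))] @ drop (j + n) xs)"
    and g_sym: "\<lbrakk>xs \<in> tuples n A; \<sigma> permutes {..<n}\<rbrakk> \<Longrightarrow> g (permute_list \<sigma> xs) = g xs"
    and distrib: "\<lbrakk>ps \<in> tuples n A; qs \<in> tuples m A; i < n\<rbrakk> \<Longrightarrow>
      lift g ((singles ps)[i := f qs]) = f (map (\<lambda>q. g (ps[i := q])) qs)"
    and g_zero: "ps \<in> tuples (n - 1) A \<Longrightarrow> g (hzero m A f # ps) = hzero m A f"
    and one_closed: "one \<in> A"
    and g_one: "p \<in> A \<Longrightarrow> g (p # replicate (n - 1) one) = p"

definition hyperideal ::
  "nat \<Rightarrow> nat \<Rightarrow> 'a set \<Rightarrow> ('a list \<Rightarrow> 'a set) \<Rightarrow> ('a list \<Rightarrow> 'a) \<Rightarrow> 'a set \<Rightarrow> bool" where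
  "hyperideal m n A f g P \<longleftrightarrow>
     P \<noteq> {} \<and> P \<subseteq> A \<and>
     (\<forall>ps\<in>tuples m P. f ps \<subseteq> P) \<and>
     (\<forall>p\<in>P. hneg m A f p \<in> P) \<and>
     (\<forall>ps\<in>tuples n A. \<forall>i<n. lift g ((singles ps)[i := P]) \<subseteq> P)"

definition proper_hyperideal ::
  "nat \<Rightarrow> nat \<Rightarrow> 'a set \<Rightarrow> ('a list \<Rightarrow> 'a set) \<Rightarrow> ('a list \<Rightarrow> 'a) \<Rightarrow> 'a set \<Rightarrow> bool" where
  "proper_hyperideal m n A f g P \<longleftrightarrow> hyperideal m n A f g P \<and> P \<noteq> A"

definition prime_hyperideal ::
  "nat \<Rightarrow> nat \<Rightarrow> 'a set \<Rightarrow> ('a list \<Rightarrow> 'a set) \<Rightarrow> ('a list \<Rightarrow> 'a) \<Rightarrow> 'a set \<Rightarrow> bool" where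
  "prime_hyperideal m n A f g P \<longleftrightarrow>
     proper_hyperideal m n A f g P \<and>
     (\<forall>ps\<in>tuples n A. g ps \<in> P \<longrightarrow> (\<exists>i<n. ps ! i \<in> P))"

definition radical ::
  "nat \<Rightarrow> nat \<Rightarrow> 'a set \<Rightarrow> ('a list \<Rightarrow> 'a set) \<Rightarrow> ('a list \<Rightarrow> 'a) \<Rightarrow> 'a set \<Rightarrow> 'a set" where
  "radical m n A f g P =
     (if \<exists>Q. prime_hyperideal m n A f g Q \<and> P \<subseteq> Q
      then \<Inter>{Q. prime_hyperideal m n A f g Q \<and> P \<subseteq> Q}
      else A)"

definition multiplicative_subset ::
  "nat \<Rightarrow> 'a set \<Rightarrow> ('a list \<Rightarrow> 'a) \<Rightarrow> 'a set \<Rightarrow> bool" where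
  "multiplicative_subset n A g S \<longleftrightarrow> S \<noteq> {} \<and> S \<subseteq> A \<and> (\<forall>ss\<in>tuples n S. g ss \<in> S)"

definition S_hyperideal ::
  "nat \<Rightarrow> nat \<Rightarrow> 'a set \<Rightarrow> ('a list \<Rightarrow> 'a set) \<Rightarrow> ('a list \<Rightarrow> 'a) \<Rightarrow> 'a \<Rightarrow> 'a set \<Rightarrow> 'a set \<Rightarrow> bool"
where
  "S_hyperideal m n A f g one S P \<longleftrightarrow>
     proper_hyperideal m n A f g P \<and>
     (\<forall>ps\<in>tuples n A. \<forall>i<n. g ps \<in> P \<longrightarrow> ps ! i \<in> S \<longrightarrow> g (ps[i := one]) \<in> P)"

definition residual ::
  "nat \<Rightarrow> 'a set \<Rightarrow> ('a list \<Rightarrow> 'a) \<Rightarrow> 'a \<Rightarrow> 'a set \<Rightarrow> 'a set \<Rightarrow> 'a set" where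
  "residual n A g one P Q = {a \<in> A. lift g ([{a}, Q] @ replicate (n - 2) {one}) \<subseteq> P}"

end

theory Submission
  imports Defs
begin

text \<open>
  The binary product \<open>x y = g(x, y, 1, \<dots>, 1)\<close> makes \<open>A\<close> a commutative monoid in which
  \<open>g\<close> is the \<open>n\<close>-fold product, and a proper hyperideal \<open>P\<close> is an \<open>S\<close>-hyperideal iff every
  \<open>s \<in> S\<close> is cancellable modulo \<open>P\<close>, that is, \<open>s a \<in> P\<close> implies \<open>a \<in> P\<close>.
  This gives (1), since \<open>s = s 1\<close>, and (3).

  For (2), suppose \<open>s a \<in> r(P)\<close> with \<open>s \<in> S\<close>, but \<open>a \<notin> Q\<close> for a prime \<open>Q \<supseteq> P\<close>. The products
  \<open>t b\<close>, with \<open>t\<close> cancellable modulo \<open>P\<close> and \<open>b \<notin> Q\<close>, form a multiplicatively closed set that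
  misses \<open>P\<close> and contains \<open>s a\<close>; a prime containing \<open>P\<close> and missing this set contradicts
  \<open>s a \<in> r(P)\<close>. Such a prime exists by Zorn's lemma: if \<open>M\<close> is maximal among the
  hyperideals missing a multiplicatively closed set \<open>T\<close>, then \<open>(M : t)\<close> also misses \<open>T\<close> for
  \<open>t \<in> T\<close>, so \<open>(M : t) = M\<close>; hence \<open>(M : x)\<close> misses \<open>T\<close> for every \<open>x \<notin> M\<close>, so \<open>(M : x) = M\<close>.
\<close>

section \<open>Elementwise form of hyperideals; intersections and unions of chains\<close>

lemma listset_singles [simp]: "listset (singles xs) = {xs}"
  by (induction xs) (auto simp: set_Cons_def)

lemma listset_singles_update:
  "i < length xs \<Longrightarrow> listset ((singles xs)[i := P]) = (\<lambda>p. xs[i := p]) ` P"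
proof (induction xs arbitrary: i)
  case (Cons x xs)
  then show ?case
    by (cases i) (auto simp: set_Cons_def)
qed simp

lemma lift_singles_update:
  "i < length xs \<Longrightarrow> lift g ((singles xs)[i := P]) = (\<lambda>p. g (xs[i := p])) ` P"
  by (simp add: lift_def listset_singles_update image_image)

lemma hyperideal_iff:
  "hyperideal m n A f g P \<longleftrightarrow>
     P \<noteq> {} \<and> P \<subseteq> A \<and> (\<forall>ps\<in>tuples m P. f ps \<subseteq> P) \<and> (\<forall>p\<in>P. hneg m A f p \<in> P) \<and>
     (\<forall>ps\<in>tuples n A. \<forall>i<n. \<forall>p\<in>P. g (ps[i := p]) \<in> P)"
  by (fastforce simp: hyperideal_def lift_singles_update tuples_def)

lemma hyperideal_Inter:
  assumes "\<C> \<noteq> {}" "\<And>I. I \<in> \<C> \<Longrightarrow> hyperideal m n A f g I" "\<Inter>\<C> \<noteq> {}"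
  shows "hyperideal m n A f g (\<Inter>\<C>)"
proof -
  have "f ps \<subseteq> I" if "ps \<in> tuples m (\<Inter>\<C>)" "I \<in> \<C>" for ps I
  proof -
    have "ps \<in> tuples m I"
      using that by (auto simp: tuples_def)
    then show ?thesis
      using assms(2)[OF that(2)] by (simp add: hyperideal_iff)
  qed
  moreover have "\<Inter>\<C> \<subseteq> A"
    using assms(1,2) unfolding hyperideal_iff by blast
  ultimately show ?thesis
    using assms unfolding hyperideal_iff by blast
qed

text \<open>A tuple has finitely many entries, so in a chain they all lie in a single member, which
  is already closed under \<open>f\<close>.\<close>

lemma hyperideal_Union_chain:
  assumes "\<C> \<noteq> {}" "\<And>I. I \<in> \<C> \<Longrightarrow> hyperideal m n A f g I" "subset.chain UNIV \<C>"
  shows "hyperideal m n A f g (\<Union>\<C>)"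
proof -
  have "f ps \<subseteq> \<Union>\<C>" if ps: "ps \<in> tuples m (\<Union>\<C>)" for ps
  proof -
    obtain I where "I \<in> \<C>" "set ps \<subseteq> I"
      using finite_subset_Union_chain[of "set ps" \<C> UNIV] assms(1,3) ps
      by (auto simp: tuples_def)
    then have "f ps \<subseteq> I"
      using assms(2)[of I] ps by (auto simp: hyperideal_iff tuples_def)
    then show ?thesis
      using \<open>I \<in> \<C>\<close> by blast
  qed
  moreover have "\<Union>\<C> \<noteq> {}" "\<Union>\<C> \<subseteq> A"
    using assms(1,2) unfolding hyperideal_iff by blast+
  ultimately show ?thesis
    using assms(2) unfolding hyperideal_iff by blast
qed

section \<open>The commutative monoid given by the binary product\<close>

context comm_krasner_hyperring
begin

abbreviation mul :: "'a \<Rightarrow> 'a \<Rightarrow> 'a" where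
  "mul x y \<equiv> g (x # y # replicate (n - 2) one)"

text \<open>Symmetry restated through multisets: every later reordering of arguments reduces to
  comparing two multisets.\<close>

lemma g_mset_cong:
  assumes "mset xs = mset ys" "ys \<in> tuples n A"
  shows "g xs = g ys"
proof -
  obtain \<sigma> where "\<sigma> permutes {..<length ys}" "permute_list \<sigma> ys = xs"
    using mset_eq_permutation[OF assms(1)] by blast
  then show ?thesis
    using g_sym[OF assms(2)] assms(2) by (auto simp: tuples_def)
qed

lemma mul_closed: "x \<in> A \<Longrightarrow> y \<in> A \<Longrightarrow> mul x y \<in> A"
  using arity_g one_closed by (intro g_closed) (auto simp: tuples_def)

lemma mul_commute: "x \<in> A \<Longrightarrow> y \<in> A \<Longrightarrow> mul x y = mul y x"
  using arity_g one_closed by (intro g_mset_cong) (auto simp: tuples_def)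

lemma replicate_one: "one # replicate (n - 2) one = replicate (n - 1) one"
  using arity_g by (simp add: replicate_Suc[symmetric] Suc_diff_Suc numeral_2_eq_2 del: replicate_Suc)

lemma mul_one: "x \<in> A \<Longrightarrow> mul x one = x"
  using g_one by (simp add: replicate_one)

text \<open>Bracket the word \<open>x, ys, 1, ..., 1\<close> of length \<open>2 * n - 1\<close> at
  its first two positions. The inner product is \<open>g (x # ys)\<close> in one case, and the outer
  ones disappear by \<open>g_one\<close>; in the other it is \<open>g (ys @ [one])\<close>,
  multiplied by \<open>x\<close>.\<close>

lemma g_Cons_eq_mul:
  assumes "x \<in> A" "ys \<in> tuples (n - 1) A"
  shows "g (x # ys) = mul x (g (one # ys))"
proof -
  have len: "length ys = n - 1" and sub: "set ys \<subseteq> A"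
    using assms(2) by (auto simp: tuples_def)
  define xs where "xs = x # ys @ replicate (n - 1) one"
  have "xs \<in> tuples (2 * n - 1) A"
    using assms(1) len sub arity_g one_closed by (auto simp: xs_def tuples_def)
  from g_assoc[OF this, of 0 1]
  have "g (g (take n xs) # drop n xs) = g (x # g (take n (drop 1 xs)) # drop (Suc n) xs)"
    using arity_g by (simp add: xs_def)
  moreover have "take n xs = x # ys" "drop n xs = replicate (n - 1) one"
    "take n (drop 1 xs) = ys @ [one]" "drop (Suc n) xs = replicate (n - 2) one"
    using len arity_g by (simp_all add: xs_def take_Cons' drop_Cons' numeral_2_eq_2)
  moreover have "x # ys \<in> tuples n A" "one # ys \<in> tuples n A"
    using assms(1) len sub arity_g one_closed by (auto simp: tuples_def)
  moreover have "g (ys @ [one]) = g (one # ys)"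
    using \<open>one # ys \<in> tuples n A\<close> by (intro g_mset_cong) auto
  ultimately show ?thesis
    using g_one[OF g_closed] by simp
qed

lemma mul_assoc:
  assumes "x \<in> A" "y \<in> A" "z \<in> A"
  shows "mul (mul x y) z = mul x (mul y z)"
proof -
  define o2 where "o2 = replicate (n - 2) one"
  have len: "length o2 = n - 2" and sub: "set o2 \<subseteq> A"
    using one_closed by (auto simp: o2_def)
  \<comment> \<open>Bracketing this word at position 0 gives \<open>mul (mul x y) z\<close>. At
    position 1 it gives \<open>mul x (mul y z)\<close>, once \<open>z\<close> is moved past the
    inner ones by symmetry.\<close>
  define xs where "xs = x # y # o2 @ z # o2"
  have "xs \<in> tuples (2 * n - 1) A"
    using assms len sub arity_g by (auto simp: xs_def tuples_def)
  from g_assoc[OF this, of 0 1]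
  have "g (g (take n xs) # drop n xs) = g (x # g (take n (drop 1 xs)) # drop (Suc n) xs)"
    using arity_g by (simp add: xs_def)
  moreover have "take n xs = x # y # o2" "drop n xs = z # o2"
    "take n (drop 1 xs) = y # o2 @ [z]" "drop (Suc n) xs = o2"
    using len arity_g by (simp_all add: xs_def take_Cons' drop_Cons' Suc_diff_le numeral_2_eq_2)
  moreover have "g (y # o2 @ [z]) = g (y # z # o2)"
    using assms len sub arity_g by (intro g_mset_cong) (auto simp: tuples_def)
  ultimately show ?thesis
    by (simp add: o2_def)
qed

lemma mul_left_commute:
  assumes "x \<in> A" "y \<in> A" "z \<in> A"
  shows "mul x (mul y z) = mul y (mul x z)"
  using assms mul_assoc mul_commute by metis

lemma g_update_closed:
  assumes "ps \<in> tuples n A" "x \<in> A"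
  shows "g (ps[i := x]) \<in> A"
  using assms set_update_subset_insert[of ps i x] by (intro g_closed) (auto simp: tuples_def)

lemma g_update_eq_mul:
  assumes "ps \<in> tuples n A" "i < n" "x \<in> A"
  shows "g (ps[i := x]) = mul x (g (ps[i := one]))"
proof -
  define ys where "ys = take i ps @ drop (Suc i) ps"
  have len: "length ps = n" and "set ps \<subseteq> A"
    using assms(1) by (auto simp: tuples_def)
  then have ys: "ys \<in> tuples (n - 1) A"
    using assms(2) set_take_subset[of i ps] set_drop_subset[of "Suc i" ps]
    by (auto simp: ys_def tuples_def)
  have "g (ps[i := y]) = g (y # ys)" if "y \<in> A" for y
    using that ys assms(2) len
    by (intro g_mset_cong) (auto simp: ys_def tuples_def upd_conv_take_nth_drop)
  then show ?thesis
    using g_Cons_eq_mul[OF assms(3) ys] assms(3) one_closed by simp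
qed

lemma g_eq_mul_nth:
  assumes "ps \<in> tuples n A" "i < n"
  shows "g ps = mul (ps ! i) (g (ps[i := one]))"
proof -
  have "ps ! i \<in> A"
    using assms nth_mem[of i ps] by (auto simp: tuples_def)
  from g_update_eq_mul[OF assms this] show ?thesis
    by simp
qed

text \<open>Shorter lists are padded with \<open>one\<close> up to length \<open>n\<close>, which
  allows induction on the list: each new entry takes the place of one padding \<open>one\<close> and
  splits off as a binary factor.\<close>

lemma g_in_submonoid:
  assumes "B \<subseteq> A" "one \<in> B" "\<And>x y. x \<in> B \<Longrightarrow> y \<in> B \<Longrightarrow> mul x y \<in> B"
    and "length xs = n" "set xs \<subseteq> B"
  shows "g xs \<in> B"
proof -
  have "g (xs @ replicate (n - length xs) one) \<in> B" if "length xs \<le> n" "set xs \<subseteq> B" for xs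
    using that
  proof (induction xs)
    case Nil
    have "replicate n one = one # replicate (n - 1) one"
      using arity_g by (cases n) auto
    then show ?case
      using g_one[OF one_closed] assms(2) by simp
  next
    case (Cons x xs)
    let ?zs = "xs @ replicate (n - length (x # xs)) one"
    have "n - length xs = Suc (n - length (x # xs))"
      using Cons.prems(1) by simp
    moreover have zs: "?zs \<in> tuples (n - 1) A"
      using Cons.prems assms(1) one_closed by (auto simp: tuples_def)
    moreover have "one # ?zs \<in> tuples n A"
      using zs arity_g one_closed by (auto simp: tuples_def)
    ultimately have "g (xs @ replicate (n - length xs) one) = g (one # ?zs)"
      by (intro g_mset_cong) auto
    moreover have "g (x # ?zs) = mul x (g (one # ?zs))"
      using g_Cons_eq_mul[OF _ zs, of x] Cons.prems assms(1) by auto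
    ultimately show ?case
      using Cons assms(3) by simp
  qed
  from this[of xs] show ?thesis
    using assms(4,5) by simp
qed

section \<open>Distributivity, zero and negatives for the binary product\<close>

lemma mul_image_f:
  assumes "q \<in> A" "xs \<in> tuples m A"
  shows "(\<lambda>x. mul x q) ` f xs = f (map (\<lambda>x. mul x q) xs)"
proof -
  \<comment> \<open>The leading \<open>one\<close> is a placeholder: distributivity at index 0
    overwrites it.\<close>
  have "one # q # replicate (n - 2) one \<in> tuples n A"
    using assms(1) one_closed arity_g by (auto simp: tuples_def)
  from distrib[OF this assms(2), of 0] show ?thesis
    using arity_g lift_singles_update[of 0 "one # q # replicate (n - 2) one" g "f xs"] by simp
qed

lemma zero_closed: "hzero m A f \<in> A"
  using theI'[OF ex1_zero] by (simp add: hzero_def is_zero_def)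

lemma zero_mul:
  assumes "q \<in> A"
  shows "mul (hzero m A f) q = hzero m A f"
proof (rule g_zero)
  show "q # replicate (n - 2) one \<in> tuples (n - 1) A"
    using assms one_closed arity_g by (auto simp: tuples_def)
qed

lemma is_neg_hneg: "p \<in> A \<Longrightarrow> is_neg m A f p (hneg m A f p)"
  unfolding hneg_def by (rule theI'[OF ex1_neg])

lemma hneg_closed: "p \<in> A \<Longrightarrow> hneg m A f p \<in> A"
  using is_neg_hneg by (simp add: is_neg_def)

text \<open>Multiplying the membership of zero in \<open>f(p, -p, 0, ..., 0)\<close> by
  \<open>q\<close> shows that \<open>(-p) q\<close> is a negative of \<open>p q\<close>; negatives
  are unique.\<close>

lemma hneg_mul:
  assumes "p \<in> A" "q \<in> A"
  shows "mul (hneg m A f p) q = hneg m A f (mul p q)"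
proof -
  let ?z = "hzero m A f"
  let ?xs = "p # hneg m A f p # replicate (m - 2) ?z"
  have "?xs \<in> tuples m A"
    using assms(1) hneg_closed zero_closed arity_f by (auto simp: tuples_def)
  moreover have "?z \<in> f ?xs"
    using is_neg_hneg[OF assms(1)] by (simp add: is_neg_def)
  ultimately have "mul ?z q \<in> f (map (\<lambda>x. mul x q) ?xs)"
    using mul_image_f[OF assms(2)] by blast
  then have "is_neg m A f (mul p q) (mul (hneg m A f p) q)"
    using assms zero_mul hneg_closed mul_closed by (simp add: is_neg_def)
  then show ?thesis
    using ex1_neg[OF mul_closed[OF assms]] is_neg_hneg[OF mul_closed[OF assms]] by blast
qed

section \<open>Hyperideals, S-hyperideals and primes in terms of the binary product\<close>

lemma hyperideal_mul:
  assumes "hyperideal m n A f g P" "p \<in> P" "x \<in> A"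
  shows "mul p x \<in> P"
proof -
  have "one # x # replicate (n - 2) one \<in> tuples n A" "0 < n"
    using assms(3) one_closed arity_g by (auto simp: tuples_def)
  then show ?thesis
    using assms(1,2) unfolding hyperideal_iff by (metis list_update_code(2))
qed

lemma hyperideal_one_imp_eq:
  assumes "hyperideal m n A f g P" "one \<in> P"
  shows "P = A"
proof
  show "A \<subseteq> P"
    using hyperideal_mul[OF assms] mul_commute mul_one one_closed by fastforce
  show "P \<subseteq> A"
    using assms(1) by (simp add: hyperideal_iff)
qed

lemma proper_hyperideal_iff:
  "proper_hyperideal m n A f g P \<longleftrightarrow> hyperideal m n A f g P \<and> one \<notin> P"
  using hyperideal_one_imp_eq one_closed by (auto simp: proper_hyperideal_def)

text \<open>Binary absorption suffices, because \<open>g_update_eq_mul\<close> factors the entry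
  from \<open>P\<close> out of any argument position, leaving a cofactor in
  \<open>A\<close>.\<close>

lemma hyperidealI:
  assumes "P \<noteq> {}" "P \<subseteq> A" "\<And>ps. ps \<in> tuples m P \<Longrightarrow> f ps \<subseteq> P"
    and "\<And>p. p \<in> P \<Longrightarrow> hneg m A f p \<in> P"
    and "\<And>p x. p \<in> P \<Longrightarrow> x \<in> A \<Longrightarrow> mul p x \<in> P"
  shows "hyperideal m n A f g P"
  using assms g_update_eq_mul g_update_closed[OF _ one_closed]
  by (auto simp: hyperideal_iff subset_iff)

lemma S_hyperideal_iff:
  assumes "S \<subseteq> A"
  shows "S_hyperideal m n A f g one S P \<longleftrightarrow>
    hyperideal m n A f g P \<and> one \<notin> P \<and> (\<forall>s\<in>S. \<forall>a\<in>A. mul s a \<in> P \<longrightarrow> a \<in> P)"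
    (is "?L \<longleftrightarrow> ?R")
proof
  assume L: ?L
  have "a \<in> P" if "s \<in> S" "a \<in> A" "mul s a \<in> P" for s a
  proof -
    let ?ps = "s # a # replicate (n - 2) one"
    have "?ps \<in> tuples n A" "0 < n" "?ps ! 0 \<in> S"
      using that assms one_closed arity_g by (auto simp: tuples_def)
    then have "g (?ps[0 := one]) \<in> P"
      using L that(3) unfolding S_hyperideal_def by blast
    then show ?thesis
      using mul_commute[OF one_closed that(2)] mul_one[OF that(2)] by simp
  qed
  then show ?R
    using L by (auto simp: S_hyperideal_def proper_hyperideal_iff)
next
  assume R: ?R
  then show ?L
    \<comment> \<open>Factoring out the entry \<open>ps ! i\<close> leaves exactly
      \<open>g (ps[i := one])\<close>, so cancelling that entry is the required condition.\<close>
    using g_eq_mul_nth g_update_closed[OF _ one_closed]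
    by (auto simp: S_hyperideal_def proper_hyperideal_iff)
qed

lemma prime_hyperideal_iff:
  "prime_hyperideal m n A f g P \<longleftrightarrow> hyperideal m n A f g P \<and> one \<notin> P \<and>
    (\<forall>x\<in>A. \<forall>y\<in>A. mul x y \<in> P \<longrightarrow> x \<in> P \<or> y \<in> P)"
    (is "?L \<longleftrightarrow> ?R")
proof
  assume L: ?L
  have "x \<in> P \<or> y \<in> P" if xy: "x \<in> A" "y \<in> A" "mul x y \<in> P" for x y
  proof -
    let ?ps = "x # y # replicate (n - 2) one"
    have ps: "?ps \<in> tuples n A"
      using that one_closed arity_g by (auto simp: tuples_def)
    then obtain i where "i < n" "?ps ! i \<in> P"
      using L xy(3) unfolding prime_hyperideal_def by blast
    moreover from \<open>i < n\<close> ps have "?ps ! i \<in> set ?ps"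
      by (intro nth_mem) (simp add: tuples_def)
    \<comment> \<open>The entry found in \<open>P\<close> could be a padding \<open>one\<close>;
      properness rules this out.\<close>
    moreover have "one \<notin> P"
      using L by (simp add: prime_hyperideal_def proper_hyperideal_iff)
    ultimately show ?thesis
      by (auto split: if_splits)
  qed
  then show ?R
    using L by (auto simp: prime_hyperideal_def proper_hyperideal_iff)
next
  assume R: ?R
  have "\<exists>i<n. ps ! i \<in> P" if "ps \<in> tuples n A" "g ps \<in> P" for ps
  proof (rule ccontr)
    assume "\<not> (\<exists>i<n. ps ! i \<in> P)"
    then have "length ps = n" "set ps \<subseteq> A - P"
      using that(1) by (auto simp: tuples_def in_set_conv_nth)
    \<comment> \<open>The binary prime condition and \<open>one \<notin> P\<close> make the
      complement of \<open>P\<close> a submonoid.\<close>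
    then have "g ps \<in> A - P"
      using R mul_closed one_closed by - (rule g_in_submonoid, auto)
    then show False
      using that(2) by simp
  qed
  then show ?L
    using R by (auto simp: prime_hyperideal_def proper_hyperideal_iff)
qed

section \<open>Residuals\<close>

lemma residual_eq: "residual n A g one P Q = {a \<in> A. \<forall>q\<in>Q. mul a q \<in> P}"
proof -
  have "lift g ([{a}, Q] @ replicate (n - 2) {one}) = mul a ` Q" for a
    using lift_singles_update[of 1 "a # one # replicate (n - 2) one" g Q]
    by (simp add: map_replicate_const)
  then show ?thesis
    by (auto simp: residual_def)
qed

lemma subset_residual:
  assumes "hyperideal m n A f g P" "Q \<subseteq> A"
  shows "P \<subseteq> residual n A g one P Q"
proof -
  have "P \<subseteq> A"
    using assms(1) by (simp add: hyperideal_iff)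
  then show ?thesis
    using hyperideal_mul[OF assms(1)] assms(2) by (auto simp: residual_eq)
qed

lemma hyperideal_residual:
  assumes P: "hyperideal m n A f g P" and Q: "Q \<subseteq> A"
  shows "hyperideal m n A f g (residual n A g one P Q)" (is "hyperideal m n A f g ?R")
proof (rule hyperidealI)
  show "?R \<noteq> {}"
    using subset_residual[OF P Q] P by (auto simp: hyperideal_iff)
  show "?R \<subseteq> A"
    by (auto simp: residual_eq)
next
  fix ps assume ps: "ps \<in> tuples m ?R"
  then have psA: "ps \<in> tuples m A"
    by (auto simp: tuples_def residual_eq)
  have "mul x q \<in> P" if "x \<in> f ps" "q \<in> Q" for x q
  proof -
    have "map (\<lambda>x. mul x q) ps \<in> tuples m P"
      using ps that(2) by (auto simp: tuples_def residual_eq)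
    then have "f (map (\<lambda>x. mul x q) ps) \<subseteq> P"
      using P by (simp add: hyperideal_iff)
    then show ?thesis
      using mul_image_f[OF _ psA, of q] that Q by blast
  qed
  then show "f ps \<subseteq> ?R"
    using f_closed[OF psA] by (auto simp: residual_eq)
next
  fix p assume "p \<in> ?R"
  then show "hneg m A f p \<in> ?R"
    using P Q hneg_mul hneg_closed by (auto simp: residual_eq hyperideal_iff subset_iff)
next
  fix p x assume p: "p \<in> ?R" and x: "x \<in> A"
  have "mul (mul p x) q \<in> P" if "q \<in> Q" for q
  proof -
    have "mul (mul p x) q = mul (mul p q) x"
      using p x that Q mul_assoc mul_commute[of x q] by (auto simp: residual_eq)
    then show ?thesis
      using hyperideal_mul[OF P _ x] p that by (auto simp: residual_eq)
  qed
  then show "mul p x \<in> ?R"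
    using p x mul_closed by (auto simp: residual_eq)
qed

lemma S_hyperideal_residual:
  assumes "S \<subseteq> A" "S_hyperideal m n A f g one S P" "Q \<noteq> {}" "Q \<subseteq> A - P"
  shows "S_hyperideal m n A f g one S (residual n A g one P Q)"
proof -
  have P: "hyperideal m n A f g P"
    and canc: "\<And>s a. s \<in> S \<Longrightarrow> a \<in> A \<Longrightarrow> mul s a \<in> P \<Longrightarrow> a \<in> P"
    using assms(2) unfolding S_hyperideal_iff[OF assms(1)] by blast+
  have Q: "Q \<subseteq> A"
    using assms(4) by blast
  obtain q where "q \<in> Q"
    using assms(3) by blast
  \<comment> \<open>This is where \<open>Q\<close> being non-empty and outside \<open>P\<close>
    gives properness: \<open>one\<close> in the residual would put \<open>q\<close> into
    \<open>P\<close>.\<close>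
  then have "mul one q = q" "q \<notin> P"
    using assms(4) mul_commute[OF one_closed] mul_one by auto
  with \<open>q \<in> Q\<close> have "one \<notin> residual n A g one P Q"
    unfolding residual_eq by (metis (mono_tags, lifting) mem_Collect_eq)
  moreover have "a \<in> residual n A g one P Q"
    if "s \<in> S" "a \<in> A" "mul s a \<in> residual n A g one P Q" for s a
  proof -
    have "mul a q \<in> P" if "q \<in> Q" for q
    proof (rule canc[OF \<open>s \<in> S\<close>])
      show "mul a q \<in> A"
        using that Q \<open>a \<in> A\<close> mul_closed by blast
      have "mul (mul s a) q \<in> P"
        using that \<open>mul s a \<in> _\<close> by (simp add: residual_eq)
      then show "mul s (mul a q) \<in> P"
        using mul_assoc[of s a q] that Q \<open>a \<in> A\<close> \<open>s \<in> S\<close> assms(1) by (simp add: subset_iff)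
    qed
    then show ?thesis
      using that(2) by (simp add: residual_eq)
  qed
  ultimately show ?thesis
    unfolding S_hyperideal_iff[OF assms(1)] using hyperideal_residual[OF P Q] by blast
qed

section \<open>Primes avoiding a multiplicatively closed set\<close>

lemma exists_prime_hyperideal_disjoint:
  assumes P: "hyperideal m n A f g P"
    and T: "T \<subseteq> A" "T \<noteq> {}" "\<And>x y. x \<in> T \<Longrightarrow> y \<in> T \<Longrightarrow> mul x y \<in> T"
    and "P \<inter> T = {}"
  obtains M where "prime_hyperideal m n A f g M" "P \<subseteq> M" "M \<inter> T = {}"
proof -
  define \<A> where "\<A> = {I. hyperideal m n A f g I \<and> P \<subseteq> I \<and> I \<inter> T = {}}"
  have "\<Union>\<C> \<in> \<A>" if "\<C> \<noteq> {}" "subset.chain \<A> \<C>" for \<C>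
  proof -
    have "\<C> \<subseteq> \<A>" "subset.chain UNIV \<C>"
      using that(2) by (auto simp: subset.chain_def)
    then have "hyperideal m n A f g (\<Union>\<C>)"
      using that(1) unfolding \<A>_def by (intro hyperideal_Union_chain) blast+
    then show ?thesis
      using \<open>\<C> \<subseteq> \<A>\<close> that(1) by (auto simp: \<A>_def)
  qed
  moreover have "P \<in> \<A>"
    using assms by (simp add: \<A>_def)
  ultimately obtain M where M: "M \<in> \<A>" and max: "\<And>I. I \<in> \<A> \<Longrightarrow> M \<subseteq> I \<Longrightarrow> I = M"
    using subset_Zorn_nonempty[of \<A>] by blast
  have id: "hyperideal m n A f g M" and "P \<subseteq> M" and disj: "M \<inter> T = {}"
    using M by (auto simp: \<A>_def)
  have step: "y \<in> M"
    if "x \<in> A" "\<And>t. t \<in> T \<Longrightarrow> mul t x \<notin> M" "y \<in> A" "mul y x \<in> M" for x y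
  proof -
    let ?R = "residual n A g one M {x}"
    have "M \<subseteq> ?R"
      using subset_residual[OF id] that(1) by simp
    moreover have "?R \<inter> T = {}"
      using that(2) by (auto simp: residual_eq)
    ultimately have "?R \<in> \<A>"
      using hyperideal_residual[OF id] that(1) \<open>P \<subseteq> M\<close> by (auto simp: \<A>_def)
    then have "?R = M"
      using max \<open>M \<subseteq> ?R\<close> by blast
    then show ?thesis
      using that(3,4) by (auto simp: residual_eq)
  qed
  \<comment> \<open>First use of maximality, on the residual by an element of \<open>T\<close>. The
    resulting cancellation of \<open>T\<close> modulo \<open>M\<close> supplies the premise of
    \<open>step\<close> for any element outside \<open>M\<close>, which then yields
    primality.\<close>
  have canc: "x \<in> M" if "t \<in> T" "x \<in> A" "mul t x \<in> M" for t x
  proof (rule step[of t x])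
    show "t \<in> A" "x \<in> A"
      using that T(1) by auto
    then show "mul x t \<in> M"
      using mul_commute[of t x] that(3) by simp
    show "mul u t \<notin> M" if "u \<in> T" for u
      using T(3)[OF that \<open>t \<in> T\<close>] disj by blast
  qed
  have "x \<in> M \<or> y \<in> M" if "x \<in> A" "y \<in> A" "mul x y \<in> M" for x y
    using step[of y x] canc that by blast
  moreover have "one \<notin> M"
    using hyperideal_one_imp_eq[OF id] T(1,2) disj by auto
  ultimately have "prime_hyperideal m n A f g M"
    using id by (simp add: prime_hyperideal_iff)
  then show thesis
    using that \<open>P \<subseteq> M\<close> disj by blast
qed

section \<open>The radical\<close>

lemma S_hyperideal_radical:
  assumes "S \<subseteq> A" "S_hyperideal m n A f g one S P"
  shows "S_hyperideal m n A f g one S (radical m n A f g P)"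
proof -
  have P: "hyperideal m n A f g P" and "one \<notin> P"
    and canc: "\<And>s a. s \<in> S \<Longrightarrow> a \<in> A \<Longrightarrow> mul s a \<in> P \<Longrightarrow> a \<in> P"
    using assms(2) unfolding S_hyperideal_iff[OF assms(1)] by blast+
  define \<Q> where "\<Q> = {Q. prime_hyperideal m n A f g Q \<and> P \<subseteq> Q}"
  \<comment> \<open>Avoiding \<open>{one}\<close> produces some prime above \<open>P\<close>, so the
    radical is a genuine intersection and not its default value \<open>A\<close>.\<close>
  obtain M where "prime_hyperideal m n A f g M" "P \<subseteq> M"
  proof (rule exists_prime_hyperideal_disjoint[OF P])
    show "{one} \<subseteq> A" "P \<inter> {one} = {}"
      using \<open>one \<notin> P\<close> one_closed by auto
    show "mul x y \<in> {one}" if "x \<in> {one}" "y \<in> {one}" for x y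
      using that mul_one[OF one_closed] by simp
  qed auto
  then have "M \<in> \<Q>"
    by (simp add: \<Q>_def)
  then have rad: "radical m n A f g P = \<Inter>\<Q>"
    by (auto simp: radical_def \<Q>_def)
  have id: "hyperideal m n A f g Q" and one_notin: "one \<notin> Q" and P_subset: "P \<subseteq> Q"
    and prime: "\<forall>x\<in>A. \<forall>y\<in>A. mul x y \<in> Q \<longrightarrow> x \<in> Q \<or> y \<in> Q" if "Q \<in> \<Q>" for Q
    using that by (simp_all add: \<Q>_def prime_hyperideal_iff)
  have "P \<subseteq> \<Inter>\<Q>" "P \<noteq> {}"
    using P by (auto simp: \<Q>_def hyperideal_def)
  then have "hyperideal m n A f g (\<Inter>\<Q>)"
    using hyperideal_Inter[of \<Q>, OF _ id] \<open>M \<in> \<Q>\<close> by blast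
  moreover have "one \<notin> \<Inter>\<Q>"
    using \<open>M \<in> \<Q>\<close> one_notin by blast
  moreover have "a \<in> Q" if "s \<in> S" "a \<in> A" "mul s a \<in> \<Inter>\<Q>" "Q \<in> \<Q>" for s a Q
  proof (rule ccontr)
    assume "a \<notin> Q"
    \<comment> \<open>\<open>S\<close> is closed only under \<open>n\<close>-fold products; the larger set \<open>C\<close> is a submonoid.\<close>
    define C where "C = {t \<in> A. \<forall>b\<in>A. mul t b \<in> P \<longrightarrow> b \<in> P}"
    define T where "T = {mul t b | t b. t \<in> C \<and> b \<in> A - Q}"
    have C_mul: "mul t u \<in> C" if tu: "t \<in> C" "u \<in> C" for t u
    proof -
      have tuA: "t \<in> A" "u \<in> A"
        using tu by (auto simp: C_def)
      have "b \<in> P" if "b \<in> A" "mul (mul t u) b \<in> P" for b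
      proof -
        have "mul t (mul u b) \<in> P"
          using that(2) mul_assoc[OF tuA that(1)] by argo
        moreover have "mul u b \<in> A"
          by (rule mul_closed[OF tuA(2) that(1)])
        ultimately show ?thesis
          using tu that(1) unfolding C_def by blast
      qed
      then show ?thesis
        using mul_closed[OF tuA] unfolding C_def by blast
    qed
    have Q_mul: "mul b c \<in> A - Q" if "b \<in> A - Q" "c \<in> A - Q" for b c
      using that prime[OF \<open>Q \<in> \<Q>\<close>] mul_closed by blast
    have "T \<subseteq> A"
      using mul_closed by (auto simp: T_def C_def)
    have "s \<in> C"
      using \<open>s \<in> S\<close> canc assms(1) by (auto simp: C_def)
    then have sa: "mul s a \<in> T"
      using \<open>a \<in> A\<close> \<open>a \<notin> Q\<close> unfolding T_def by blast
    have T_mul: "mul x y \<in> T" if xy: "x \<in> T" "y \<in> T" for x y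
    proof -
      obtain t b u c where tb: "t \<in> C" "b \<in> A - Q" "x = mul t b"
        and uc: "u \<in> C" "c \<in> A - Q" "y = mul u c"
        using xy by (auto simp: T_def)
      then have "t \<in> A" "b \<in> A" "u \<in> A" "c \<in> A"
        by (auto simp: C_def)
      \<comment> \<open>Regrouping collects the cancellable factors on one side and the factors
        outside \<open>Q\<close> on the other.\<close>
      then have "mul x y = mul (mul t u) (mul b c)"
        using tb(3) uc(3) by (simp add: mul_assoc mul_left_commute[of b u c] mul_closed)
      then show ?thesis
        using C_mul[OF tb(1) uc(1)] Q_mul[OF tb(2) uc(2)] unfolding T_def by blast
    qed
    \<comment> \<open>If \<open>mul t b\<close> were in \<open>P\<close>, cancelling
      \<open>t\<close> would put \<open>b\<close> into \<open>P\<close>, hence into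
      \<open>Q\<close>.\<close>
    have "P \<inter> T = {}"
      using P_subset[OF \<open>Q \<in> \<Q>\<close>] by (auto simp: T_def C_def)
    obtain N where "prime_hyperideal m n A f g N" "P \<subseteq> N" "N \<inter> T = {}"
      using exists_prime_hyperideal_disjoint[OF P \<open>T \<subseteq> A\<close> _ T_mul \<open>P \<inter> T = {}\<close>] sa by blast
    \<comment> \<open>\<open>N\<close> is one of the primes being intersected, so it contains
      \<open>mul s a\<close>, which also lies in \<open>T\<close>.\<close>
    then show False
      using sa \<open>mul s a \<in> \<Inter>\<Q>\<close> by (auto simp: \<Q>_def)
  qed
  ultimately show ?thesis
    unfolding rad S_hyperideal_iff[OF assms(1)] by blast
qed

section \<open>Disjointness from \<open>S\<close>, and the three claims together\<close>

lemma S_hyperideal_disjoint: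
  assumes "S \<subseteq> A" "S_hyperideal m n A f g one S P"
  shows "P \<inter> S = {}"
proof -
  have "s \<notin> P" if "s \<in> S" for s
    using assms that one_closed mul_one[of s] by (auto simp: S_hyperideal_iff[OF assms(1)])
  then show ?thesis
    by blast
qed

end

theorem theorem3p3:
  fixes m n :: nat and A :: "'a set" and f :: "'a list \<Rightarrow> 'a set"
    and g :: "'a list \<Rightarrow> 'a" and one :: 'a and S P :: "'a set"
  assumes "comm_krasner_hyperring m n A f g one"
    and "multiplicative_subset n A g S"
    and "S_hyperideal m n A f g one S P"
  shows "P \<inter> S = {} \<and>
    S_hyperideal m n A f g one S (radical m n A f g P) \<and>
    (\<forall>Q. Q \<noteq> {} \<and> Q \<subseteq> A - P \<longrightarrow>
         S_hyperideal m n A f g one S (residual n A g one P Q))"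
proof -
  interpret comm_krasner_hyperring m n A f g one
    by (rule assms(1))
  have "S \<subseteq> A"
    using assms(2) by (simp add: multiplicative_subset_def)
  then show ?thesis
    using S_hyperideal_disjoint[OF _ assms(3)] S_hyperideal_radical[OF _ assms(3)]
      S_hyperideal_residual[OF _ assms(3)] by simp
qed

end
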